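(* The rule ($\rho7$): from $(p\rightsquigarrow\phi)\wedge p\to\psi$ infer $\phi\to\psi$ (where $p$ is a propositional variable not occurring in $\phi,\psi$) is admissible in $\mathsf{MS^2IC}$: whenever $(p\rightsquigarrow\phi)\wedge p\to\psi$ is a theorem of $\mathsf{MS^2IC}$ with $p$ not occurring in $\phi,\psi$, so is $\phi\to\psi$.
   Context: Language: propositional variables, $\top,\bot$, $\neg,\wedge,\vee,\to,\leftrightarrow$, a binary connective $\rightsquigarrow$ and a unary modality $\Box$; $\Diamond\phi:=\neg\Box\neg\phi$, $[\forall]\phi:=\top\rightsquigarrow\phi$. $\mathsf{MS^2IC}$: theorems are the least set containing all instances of classical tautologies and of (A1) $(\bot\rightsquigarrow\phi)\wedge(\phi\rightsquigarrow\top)$; (A2) $((\phi\vee\psi)\rightsquigarrow\chi)\leftrightarrow((\phi\rightsquigarrow\chi)\wedge(\psi\rightsquigarrow\chi))$; (A3) $(\phi\rightsquigarrow(\psi\wedge\chi))\leftrightarrow((\phi\rightsquigarrow\psi)\wedge(\phi\rightsquigarrow\chi))$; (A4) $(\phi\rightsquigarrow\psi)\to(\phi\to\psi)$; (A5) $(\phi\rightsquigarrow\psi)\leftrightarrow(\neg\psi\rightsquigarrow\neg\phi)$; (A8) $[\forall]\phi\to[\forall][\forall]\phi$; (A9) $\neg[\forall]\phi\to[\forall]\neg[\forall]\phi$; (A10) $(\phi\rightsquigarrow\psi)\leftrightarrow[\forall](\phi\rightsquigarrow\psi)$; (A11) $[\forall]\phi\to(\neg[\forall]\phi\rightsquigarrow\bot)$;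 (K) $\Box(\phi\to\psi)\to(\Box\phi\to\Box\psi)$; (Add) $(\phi\rightsquigarrow\psi)\to(\Box\phi\rightsquigarrow\Box\psi)$; closed under modus ponens, from $\phi$ infer $[\forall]\phi$, from $\phi$ infer $\Box\phi$. *)

theory Defs
  imports Main
begin

datatype fm =
    Var nat
  | Top  (\<open>\<^bold>\<top>\<close>)
  | Bot  (\<open>\<^bold>\<bottom>\<close>)
  | Neg fm  (\<open>\<^bold>\<not> _\<close> [80] 80)
  | And fm fm  (infixr \<open>\<^bold>\<and>\<close> 65)
  | Or fm fm  (infixr \<open>\<^bold>\<or>\<close> 60)
  | Imp fm fm  (infixr \<open>\<^bold>\<rightarrow>\<close> 55)
  | Iff fm fm  (infix \<open>\<^bold>\<leftrightarrow>\<close> 53)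
  | SImp fm fm  (infix \<open>\<^bold>\<leadsto>\<close> 70)
  | Box fm  (\<open>\<^bold>\<box> _\<close> [80] 80)

abbreviation All :: "fm \<Rightarrow> fm"  (\<open>[\<^bold>\<forall>] _\<close> [80] 80)
  where "[\<^bold>\<forall>] \<phi> \<equiv> \<^bold>\<top> \<^bold>\<leadsto> \<phi>"

primrec vars :: "fm \<Rightarrow> nat set" where
  "vars (Var n) = {n}"
| "vars \<^bold>\<top> = {}"
| "vars \<^bold>\<bottom> = {}"
| "vars (\<^bold>\<not> \<phi>) = vars \<phi>"
| "vars (\<phi> \<^bold>\<and> \<psi>) = vars \<phi> \<union> vars \<psi>"
| "vars (\<phi> \<^bold>\<or> \<psi>) = vars \<phi> \<union> vars \<psi>"
| "vars (\<phi> \<^bold>\<rightarrow> \<psi>) = vars \<phi> \<union> vars \<psi>"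
| "vars (\<phi> \<^bold>\<leftrightarrow> \<psi>) = vars \<phi> \<union> vars \<psi>"
| "vars (\<phi> \<^bold>\<leadsto> \<psi>) = vars \<phi> \<union> vars \<psi>"
| "vars (\<^bold>\<box> \<phi>) = vars \<phi>"

text \<open>Formulas of classical propositional logic are a separate type, so that instances of
  classical tautologies are literally substitution instances, with arbitrary modal formulas
  in place of the propositional variables.\<close>

datatype pfm =
    PVar nat
  | PTop
  | PBot
  | PNeg pfm
  | PAnd pfm pfm
  | POr pfm pfm
  | PImp pfm pfm
  | PIff pfm pfm

primrec peval :: "(nat \<Rightarrow> bool) \<Rightarrow> pfm \<Rightarrow> bool" where
  "peval v (PVar n) = v n"
| "peval v PTop = True"
| "peval v PBot = False"
| "peval v (PNeg a) = (\<not> peval v a)"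
| "peval v (PAnd a b) = (peval v a \<and> peval v b)"
| "peval v (POr a b) = (peval v a \<or> peval v b)"
| "peval v (PImp a b) = (peval v a \<longrightarrow> peval v b)"
| "peval v (PIff a b) = (peval v a \<longleftrightarrow> peval v b)"

definition tautology :: "pfm \<Rightarrow> bool" where
  "tautology a \<longleftrightarrow> (\<forall>v. peval v a)"

primrec inst :: "(nat \<Rightarrow> fm) \<Rightarrow> pfm \<Rightarrow> fm" where
  "inst \<sigma> (PVar n) = \<sigma> n"
| "inst \<sigma> PTop = \<^bold>\<top>"
| "inst \<sigma> PBot = \<^bold>\<bottom>"
| "inst \<sigma> (PNeg a) = \<^bold>\<not> inst \<sigma> a"
| "inst \<sigma> (PAnd a b) = inst \<sigma> a \<^bold>\<and> inst \<sigma> b"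
| "inst \<sigma> (POr a b) = inst \<sigma> a \<^bold>\<or> inst \<sigma> b"
| "inst \<sigma> (PImp a b) = inst \<sigma> a \<^bold>\<rightarrow> inst \<sigma> b"
| "inst \<sigma> (PIff a b) = inst \<sigma> a \<^bold>\<leftrightarrow> inst \<sigma> b"

inductive MS2IC :: "fm \<Rightarrow> bool" where
  Taut: "tautology a \<Longrightarrow> MS2IC (inst \<sigma> a)"
| A1: "MS2IC ((\<^bold>\<bottom> \<^bold>\<leadsto> \<phi>) \<^bold>\<and> (\<phi> \<^bold>\<leadsto> \<^bold>\<top>))"
| A2: "MS2IC (((\<phi> \<^bold>\<or> \<psi>) \<^bold>\<leadsto> \<chi>) \<^bold>\<leftrightarrow> ((\<phi> \<^bold>\<leadsto> \<chi>) \<^bold>\<and> (\<psi> \<^bold>\<leadsto> \<chi>)))"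
| A3: "MS2IC ((\<phi> \<^bold>\<leadsto> (\<psi> \<^bold>\<and> \<chi>)) \<^bold>\<leftrightarrow> ((\<phi> \<^bold>\<leadsto> \<psi>) \<^bold>\<and> (\<phi> \<^bold>\<leadsto> \<chi>)))"
| A4: "MS2IC ((\<phi> \<^bold>\<leadsto> \<psi>) \<^bold>\<rightarrow> (\<phi> \<^bold>\<rightarrow> \<psi>))"
| A5: "MS2IC ((\<phi> \<^bold>\<leadsto> \<psi>) \<^bold>\<leftrightarrow> ((\<^bold>\<not> \<psi>) \<^bold>\<leadsto> (\<^bold>\<not> \<phi>)))"
| A8: "MS2IC (([\<^bold>\<forall>] \<phi>) \<^bold>\<rightarrow> ([\<^bold>\<forall>] ([\<^bold>\<forall>] \<phi>)))"
| A9: "MS2IC ((\<^bold>\<not> ([\<^bold>\<forall>] \<phi>)) \<^bold>\<rightarrow> ([\<^bold>\<forall>] (\<^bold>\<not> ([\<^bold>\<forall>] \<phi>))))"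
| A10: "MS2IC ((\<phi> \<^bold>\<leadsto> \<psi>) \<^bold>\<leftrightarrow> ([\<^bold>\<forall>] (\<phi> \<^bold>\<leadsto> \<psi>)))"
| A11: "MS2IC (([\<^bold>\<forall>] \<phi>) \<^bold>\<rightarrow> ((\<^bold>\<not> ([\<^bold>\<forall>] \<phi>)) \<^bold>\<leadsto> \<^bold>\<bottom>))"
| K: "MS2IC ((\<^bold>\<box> (\<phi> \<^bold>\<rightarrow> \<psi>)) \<^bold>\<rightarrow> ((\<^bold>\<box> \<phi>) \<^bold>\<rightarrow> (\<^bold>\<box> \<psi>)))"
| Add: "MS2IC ((\<phi> \<^bold>\<leadsto> \<psi>) \<^bold>\<rightarrow> ((\<^bold>\<box> \<phi>) \<^bold>\<leadsto> (\<^bold>\<box> \<psi>)))"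
| MP: "MS2IC (\<phi> \<^bold>\<rightarrow> \<psi>) \<Longrightarrow> MS2IC \<phi> \<Longrightarrow> MS2IC \<psi>"
| Nec_All: "MS2IC \<phi> \<Longrightarrow> MS2IC ([\<^bold>\<forall>] \<phi>)"
| Nec_Box: "MS2IC \<phi> \<Longrightarrow> MS2IC (\<^bold>\<box> \<phi>)"

end

theory Submission
  imports Defs "HOL-Library.Countable"
begin

text \<open>The axioms and rules do not include replacement of provable equivalents under \<open>\<^bold>\<leadsto>\<close>,
  nor monotonicity of \<open>[\<^bold>\<forall>]\<close>, so \<open>\<^bold>\<leadsto>\<close> is treated as a relation between formulas rather than
  between elements of an algebra.
  If \<open>\<phi> \<^bold>\<rightarrow> \<psi>\<close> is not a theorem, take a maximal theory \<open>w\<close> omitting it, and let \<open>G\<close> be the theory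
  generated by the strict implications and negated strict implications in \<open>w\<close>; it is closed under
  \<open>\<^bold>\<box>\<close>. Interpret \<open>p\<close> as \<open>\<phi>\<close>, leave strict implications without \<open>p\<close> alone, and make a
  strict implication \<open>a \<^bold>\<leadsto> b\<close> containing \<open>p\<close> true whenever possible: the interpretation of
  \<open>a \<^bold>\<rightarrow> b\<close> must be in \<open>G\<close>, and A2, A3, A5 must not reduce \<open>a \<^bold>\<leadsto> b\<close> to a conjunction with a
  \<open>p\<close>-free conjunct that fails in \<open>w\<close>. All theorems are interpreted by members of \<open>G\<close>, while
  \<open>(p \<^bold>\<leadsto> \<phi>) \<^bold>\<and> p \<^bold>\<rightarrow> \<psi>\<close> becomes \<open>\<^bold>\<top> \<^bold>\<and> \<phi> \<^bold>\<rightarrow> \<psi>\<close>, which is not in \<open>w\<close>.\<close>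

section \<open>Tautologies, with variables, strict implications and boxes as atoms\<close>

instance fm :: countable
  by countable_datatype

primrec beval :: "(fm \<Rightarrow> bool) \<Rightarrow> fm \<Rightarrow> bool" where
  "beval v (Var n) = v (Var n)"
| "beval v \<^bold>\<top> = True"
| "beval v \<^bold>\<bottom> = False"
| "beval v (\<^bold>\<not> a) = (\<not> beval v a)"
| "beval v (a \<^bold>\<and> b) = (beval v a \<and> beval v b)"
| "beval v (a \<^bold>\<or> b) = (beval v a \<or> beval v b)"
| "beval v (a \<^bold>\<rightarrow> b) = (beval v a \<longrightarrow> beval v b)"
| "beval v (a \<^bold>\<leftrightarrow> b) = (beval v a \<longleftrightarrow> beval v b)"
| "beval v (a \<^bold>\<leadsto> b) = v (a \<^bold>\<leadsto> b)"
| "beval v (\<^bold>\<box> a) = v (\<^bold>\<box> a)"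

text \<open>\<open>to_nat\<close> names each atom by a propositional variable, so that substituting
  along \<open>from_nat\<close> recovers the formula.\<close>

primrec skeleton :: "fm \<Rightarrow> pfm" where
  "skeleton (Var n) = PVar (to_nat (Var n))"
| "skeleton \<^bold>\<top> = PTop"
| "skeleton \<^bold>\<bottom> = PBot"
| "skeleton (\<^bold>\<not> a) = PNeg (skeleton a)"
| "skeleton (a \<^bold>\<and> b) = PAnd (skeleton a) (skeleton b)"
| "skeleton (a \<^bold>\<or> b) = POr (skeleton a) (skeleton b)"
| "skeleton (a \<^bold>\<rightarrow> b) = PImp (skeleton a) (skeleton b)"
| "skeleton (a \<^bold>\<leftrightarrow> b) = PIff (skeleton a) (skeleton b)"
| "skeleton (a \<^bold>\<leadsto> b) = PVar (to_nat (a \<^bold>\<leadsto> b))"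
| "skeleton (\<^bold>\<box> a) = PVar (to_nat (\<^bold>\<box> a))"

lemma inst_skeleton: "inst from_nat (skeleton a) = a"
  by (induction a) auto

lemma peval_skeleton: "peval v (skeleton a) = beval (v \<circ> to_nat) a"
  by (induction a) auto

text \<open>Reduces provability of a tautology instance to a truth-value check that simplification
  can settle.\<close>

lemma MS2IC_taut:
  assumes "\<And>v. beval v a"
  shows "MS2IC a"
proof -
  have "tautology (skeleton a)"
    using assms by (simp add: tautology_def peval_skeleton)
  from Taut[OF this, of from_nat] show ?thesis
    by (simp add: inst_skeleton)
qed

section \<open>Theories and maximal theories\<close>

text \<open>Closure under modus ponens alone, without necessitation, is what lets
  \<open>theory_set_adjoin\<close> add an arbitrary premise.\<close>

definition theory_set :: "fm set \<Rightarrow> bool" where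
  "theory_set w \<longleftrightarrow> (\<forall>a. MS2IC a \<longrightarrow> a \<in> w) \<and> (\<forall>a b. (a \<^bold>\<rightarrow> b) \<in> w \<longrightarrow> a \<in> w \<longrightarrow> b \<in> w)"

lemma theory_set_thm: "theory_set w \<Longrightarrow> MS2IC a \<Longrightarrow> a \<in> w"
  and theory_set_MP: "theory_set w \<Longrightarrow> (a \<^bold>\<rightarrow> b) \<in> w \<Longrightarrow> a \<in> w \<Longrightarrow> b \<in> w"
  by (auto simp: theory_set_def)

lemma theory_set_taut1:
  assumes "theory_set w" "a \<in> w" "\<And>v. beval v a \<Longrightarrow> beval v b"
  shows "b \<in> w"
  using theory_set_MP[OF assms(1) theory_set_thm[OF assms(1) MS2IC_taut[of "a \<^bold>\<rightarrow> b"]] assms(2)]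
    assms(3) by simp

lemma theory_set_taut2:
  assumes "theory_set w" "a \<in> w" "b \<in> w" "\<And>v. beval v a \<Longrightarrow> beval v b \<Longrightarrow> beval v c"
  shows "c \<in> w"
  by (rule theory_set_MP[OF assms(1) theory_set_taut1[OF assms(1,2)] assms(3)])
     (use assms(4) in simp)

lemma theory_set_adjoin:
  assumes "theory_set w"
  shows "theory_set {b. (a \<^bold>\<rightarrow> b) \<in> w}"
  unfolding theory_set_def mem_Collect_eq
proof (intro conjI allI impI)
  fix b assume "MS2IC b"
  then show "(a \<^bold>\<rightarrow> b) \<in> w"
    using theory_set_taut1[OF assms theory_set_thm[OF assms]] by simp
next
  fix b c assume "(a \<^bold>\<rightarrow> b \<^bold>\<rightarrow> c) \<in> w" "(a \<^bold>\<rightarrow> b) \<in> w"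
  then show "(a \<^bold>\<rightarrow> c) \<in> w"
    by (rule theory_set_taut2[OF assms]) simp
qed

text \<open>Lindenbaum's lemma by Zorn: maximality among the theories omitting \<open>c\<close>
  yields negation completeness.\<close>

lemma maximal_theory_exists:
  assumes "\<not> MS2IC c"
  obtains w where "theory_set w" "c \<notin> w" "\<And>a. (\<^bold>\<not> a) \<in> w \<longleftrightarrow> a \<notin> w"
proof -
  let ?A = "{w. theory_set w \<and> c \<notin> w}"
  have "theory_set {a. MS2IC a}"
    by (auto simp: theory_set_def intro: MP)
  then have ne: "?A \<noteq> {}"
    using assms by blast
  have ch: "\<Union>C \<in> ?A" if "C \<noteq> {}" "subset.chain ?A C" for C
  proof -
    have C: "\<And>x. x \<in> C \<Longrightarrow> theory_set x \<and> c \<notin> x"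
      and tot: "\<And>x y. x \<in> C \<Longrightarrow> y \<in> C \<Longrightarrow> x \<subseteq> y \<or> y \<subseteq> x"
      using that(2) by (auto simp: subset_chain_def)
    have "b \<in> \<Union>C" if ab: "(a \<^bold>\<rightarrow> b) \<in> \<Union>C" "a \<in> \<Union>C" for a b
    proof -
      obtain x y where "x \<in> C" "y \<in> C" "(a \<^bold>\<rightarrow> b) \<in> x" "a \<in> y"
        using ab by blast
      then obtain z where "z \<in> C" "(a \<^bold>\<rightarrow> b) \<in> z" "a \<in> z"
        using tot by blast
      then show ?thesis
        using C theory_set_MP by blast
    qed
    moreover have "a \<in> \<Union>C" if "MS2IC a" for a
      using \<open>C \<noteq> {}\<close> C theory_set_thm that by blast
    ultimately show ?thesis
      using C unfolding theory_set_def by blast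
  qed
  obtain w where w: "theory_set w" "c \<notin> w"
    and max: "\<And>x. theory_set x \<Longrightarrow> c \<notin> x \<Longrightarrow> w \<subseteq> x \<Longrightarrow> x = w"
    using subset_Zorn_nonempty[OF ne ch] by blast
  \<comment> \<open>Otherwise adjoining \<open>a\<close> gives a theory still omitting
    \<open>c\<close>, which equals \<open>w\<close> by maximality and yet contains
    \<open>a\<close>.\<close>
  have imp: "(a \<^bold>\<rightarrow> c) \<in> w" if "a \<notin> w" for a
  proof (rule ccontr)
    assume n: "(a \<^bold>\<rightarrow> c) \<notin> w"
    have "w \<subseteq> {b. (a \<^bold>\<rightarrow> b) \<in> w}"
      using theory_set_taut1[OF w(1)] by auto
    with n have "{b. (a \<^bold>\<rightarrow> b) \<in> w} = w"
      using max[OF theory_set_adjoin[OF w(1)]] by simp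
    moreover have "(a \<^bold>\<rightarrow> a) \<in> w"
      by (rule theory_set_thm[OF w(1) MS2IC_taut]) simp
    ultimately show False
      using that by blast
  qed
  have "(\<^bold>\<not> a) \<in> w \<longleftrightarrow> a \<notin> w" for a
  proof
    assume "(\<^bold>\<not> a) \<in> w"
    then show "a \<notin> w"
      using theory_set_taut2[OF w(1), of "\<^bold>\<not> a" a c] w(2) by auto
  next
    assume "a \<notin> w"
    then have "(a \<^bold>\<rightarrow> c) \<in> w"
      by (rule imp)
    \<comment> \<open>If neither \<open>a\<close> nor its negation were in \<open>w\<close>, both
      would imply \<open>c\<close> in \<open>w\<close>, so \<open>c\<close> would be in
      \<open>w\<close>.\<close>
    then show "(\<^bold>\<not> a) \<in> w"
      using theory_set_taut2[OF w(1) _ imp[of "\<^bold>\<not> a"], of "a \<^bold>\<rightarrow> c" c] w(2) by auto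
  qed
  with w show ?thesis
    by (rule that)
qed

section \<open>The strict implications decided by a maximal theory\<close>

locale maximal_theory =
  fixes w :: "fm set"
  assumes theory_w: "theory_set w"
    and neg_w: "(\<^bold>\<not> a) \<in> w \<longleftrightarrow> a \<notin> w"
begin

lemmas thm_w = theory_set_thm[OF theory_w]
lemmas MP_w = theory_set_MP[OF theory_w]

lemma Iff_w: "MS2IC (a \<^bold>\<leftrightarrow> b) \<Longrightarrow> a \<in> w \<longleftrightarrow> b \<in> w"
  using theory_set_taut2[OF theory_w thm_w[of "a \<^bold>\<leftrightarrow> b"], of a b]
    theory_set_taut2[OF theory_w thm_w[of "a \<^bold>\<leftrightarrow> b"], of b a] by auto

lemma And_w: "(a \<^bold>\<and> b) \<in> w \<longleftrightarrow> a \<in> w \<and> b \<in> w"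
  using theory_set_taut1[OF theory_w, of "a \<^bold>\<and> b" a] theory_set_taut1[OF theory_w, of "a \<^bold>\<and> b" b]
    theory_set_taut2[OF theory_w, of a b "a \<^bold>\<and> b"] by auto

lemma SImp_Bot_w: "(\<^bold>\<bottom> \<^bold>\<leadsto> a) \<in> w"
  and SImp_Top_w: "(a \<^bold>\<leadsto> \<^bold>\<top>) \<in> w"
  using thm_w[OF A1] by (simp_all add: And_w)

lemma SImp_Or_w: "((a \<^bold>\<or> b) \<^bold>\<leadsto> c) \<in> w \<longleftrightarrow> (a \<^bold>\<leadsto> c) \<in> w \<and> (b \<^bold>\<leadsto> c) \<in> w"
  using Iff_w[OF A2] by (simp add: And_w)

lemma SImp_And_w: "(a \<^bold>\<leadsto> (b \<^bold>\<and> c)) \<in> w \<longleftrightarrow> (a \<^bold>\<leadsto> b) \<in> w \<and> (a \<^bold>\<leadsto> c) \<in> w"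
  using Iff_w[OF A3] by (simp add: And_w)

lemma SImp_Neg_w: "((\<^bold>\<not> b) \<^bold>\<leadsto> (\<^bold>\<not> a)) \<in> w \<longleftrightarrow> (a \<^bold>\<leadsto> b) \<in> w"
  using Iff_w[OF A5] by simp

lemma All_SImp_w: "([\<^bold>\<forall>] (a \<^bold>\<leadsto> b)) \<in> w \<longleftrightarrow> (a \<^bold>\<leadsto> b) \<in> w"
  using Iff_w[OF A10] by simp

lemma All_Neg_All_w: "([\<^bold>\<forall>] a) \<notin> w \<Longrightarrow> ([\<^bold>\<forall>] (\<^bold>\<not> ([\<^bold>\<forall>] a))) \<in> w"
  using MP_w[OF thm_w[OF A9]] by (simp add: neg_w)

lemma Add_w: "(a \<^bold>\<leadsto> b) \<in> w \<Longrightarrow> ((\<^bold>\<box> a) \<^bold>\<leadsto> (\<^bold>\<box> b)) \<in> w"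
  using MP_w[OF thm_w[OF Add]] .

inductive_set G :: "fm set" where
  provable: "MS2IC a \<Longrightarrow> a \<in> G"
| pos: "(a \<^bold>\<leadsto> b) \<in> w \<Longrightarrow> (a \<^bold>\<leadsto> b) \<in> G"
| neg: "(a \<^bold>\<leadsto> b) \<notin> w \<Longrightarrow> (\<^bold>\<not> (a \<^bold>\<leadsto> b)) \<in> G"
| mp: "(a \<^bold>\<rightarrow> b) \<in> G \<Longrightarrow> a \<in> G \<Longrightarrow> b \<in> G"

lemma G_subset_w: "a \<in> G \<Longrightarrow> a \<in> w"
  by (induction rule: G.induct) (auto simp: neg_w intro: thm_w MP_w)

lemma theory_G: "theory_set G"
  by (auto simp: theory_set_def intro: G.intros)

lemma G_taut: "(\<And>v. beval v a) \<Longrightarrow> a \<in> G"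
  by (rule G.provable[OF MS2IC_taut])

lemmas G_taut1 = theory_set_taut1[OF theory_G]
lemmas G_taut2 = theory_set_taut2[OF theory_G]

lemma Imp_G_of_SImp_w: "(a \<^bold>\<leadsto> b) \<in> w \<Longrightarrow> (a \<^bold>\<rightarrow> b) \<in> G"
  by (rule G.mp[OF G.provable[OF A4] G.pos])

text \<open>\<open>Add\<close> turns a strict implication from top into one from boxed top, and
  boxed top is a theorem.\<close>

lemma Box_G_of_All_w:
  assumes "([\<^bold>\<forall>] a) \<in> w"
  shows "(\<^bold>\<box> a) \<in> G"
proof -
  have "MS2IC (\<^bold>\<box> \<^bold>\<top>)"
    by (rule Nec_Box[OF MS2IC_taut]) simp
  then show ?thesis
    using G.mp[OF Imp_G_of_SImp_w[OF Add_w[OF assms]]] G.provable by blast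
qed

text \<open>The truth value of a strict implication in \<open>w\<close> is necessary there: A10
  covers the positive generators, A9 with A10 the negated ones. K handles modus ponens.\<close>

lemma Box_G: "a \<in> G \<Longrightarrow> (\<^bold>\<box> a) \<in> G"
proof (induction rule: G.induct)
  case (provable a)
  then show ?case by (intro G.provable Nec_Box)
next
  case (pos a b)
  then show ?case by (intro Box_G_of_All_w) (simp add: All_SImp_w)
next
  case (neg a b)
  then have "(\<^bold>\<box> (\<^bold>\<not> ([\<^bold>\<forall>] (a \<^bold>\<leadsto> b)))) \<in> G"
    by (intro Box_G_of_All_w All_Neg_All_w) (simp add: All_SImp_w)
  \<comment> \<open>A9 speaks only about the negation of an \<open>All\<close> formula. That inner
    \<open>All\<close> is removed inside the box by A10 and K, since replacement under strict
    implication is not at hand.\<close>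
  moreover have "MS2IC ((\<^bold>\<not> ([\<^bold>\<forall>] (a \<^bold>\<leadsto> b))) \<^bold>\<rightarrow> \<^bold>\<not> (a \<^bold>\<leadsto> b))"
    by (rule MP[OF MS2IC_taut A10[of a b]]) simp
  ultimately show ?case
    using G.mp[OF G.mp[OF G.provable[OF K] G.provable[OF Nec_Box]]] by blast
next
  case (mp a b)
  then show ?case using G.mp[OF G.mp[OF G.provable[OF K]]] by blast
qed

end

section \<open>Obstruction by \<open>p\<close>-free strict implications that fail in
  \<open>w\<close>\<close>

locale fresh_interpretation = maximal_theory +
  fixes p :: nat and \<phi> :: fm
  assumes fresh: "p \<notin> vars \<phi>"
begin

text \<open>As a least relation, failure spreads only along A2, A3 and A5, so every pair not forced
  to fail may still hold.\<close>

inductive obstructed :: "fm \<Rightarrow> fm \<Rightarrow> bool" where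
  base: "p \<notin> vars (a \<^bold>\<leadsto> b) \<Longrightarrow> (a \<^bold>\<leadsto> b) \<notin> w \<Longrightarrow> obstructed a b"
| OrL: "obstructed a c \<Longrightarrow> obstructed (a \<^bold>\<or> b) c"
| OrR: "obstructed b c \<Longrightarrow> obstructed (a \<^bold>\<or> b) c"
| AndL: "obstructed c a \<Longrightarrow> obstructed c (a \<^bold>\<and> b)"
| AndR: "obstructed c b \<Longrightarrow> obstructed c (a \<^bold>\<and> b)"
| Neg: "obstructed a b \<Longrightarrow> obstructed (\<^bold>\<not> b) (\<^bold>\<not> a)"

text \<open>A derivation of a \<open>p\<close>-free pair stays \<open>p\<close>-free, and
  \<open>w\<close> respects A2, A3 and A5.\<close>

lemma obstructed_fresh:
  "obstructed a b \<Longrightarrow> p \<notin> vars (a \<^bold>\<leadsto> b) \<Longrightarrow> (a \<^bold>\<leadsto> b) \<notin> w"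
  by (induction rule: obstructed.induct) (auto simp: SImp_Or_w SImp_And_w SImp_Neg_w)

text \<open>Inversion alone is too weak: the last clause may concern a conjunction in
  \<open>c\<close> and leave the disjunction intact, hence the induction. Its base case is A2 in
  \<open>w\<close>.\<close>

lemma obstructed_Or: "obstructed (a \<^bold>\<or> b) c \<longleftrightarrow> obstructed a c \<or> obstructed b c"
proof
  assume "obstructed (a \<^bold>\<or> b) c"
  then show "obstructed a c \<or> obstructed b c"
    by (induction "a \<^bold>\<or> b" c rule: obstructed.induct)
       (auto simp: SImp_Or_w intro: obstructed.intros)
qed (auto intro: obstructed.intros)

lemma obstructed_And: "obstructed c (a \<^bold>\<and> b) \<longleftrightarrow> obstructed c a \<or> obstructed c b"
proof
  assume "obstructed c (a \<^bold>\<and> b)"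
  then show "obstructed c a \<or> obstructed c b"
    by (induction c "a \<^bold>\<and> b" rule: obstructed.induct)
       (auto simp: SImp_And_w intro: obstructed.intros)
qed (auto intro: obstructed.intros)

text \<open>Two negations match only \<open>base\<close> and \<open>Neg\<close>, so inversion
  suffices.\<close>

lemma obstructed_Neg: "obstructed (\<^bold>\<not> b) (\<^bold>\<not> a) \<longleftrightarrow> obstructed a b"
proof
  assume "obstructed (\<^bold>\<not> b) (\<^bold>\<not> a)"
  then show "obstructed a b"
    by cases (auto simp: SImp_Neg_w intro: obstructed.intros)
qed (rule obstructed.Neg)

lemma not_obstructed_Bot: "\<not> obstructed \<^bold>\<bottom> a"
proof
  assume "obstructed \<^bold>\<bottom> a"
  then show False
    by (induction "\<^bold>\<bottom>" a rule: obstructed.induct) (auto simp: SImp_Bot_w)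
qed

lemma not_obstructed_Top: "\<not> obstructed a \<^bold>\<top>"
proof
  assume "obstructed a \<^bold>\<top>"
  then show False
    by (induction a "\<^bold>\<top>" rule: obstructed.induct) (auto simp: SImp_Top_w)
qed

text \<open>A variable on the left leaves only \<open>base\<close> and the conjunction clauses, and
  \<open>base\<close> excludes \<open>p\<close>.\<close>

lemma not_obstructed_Var: "\<not> obstructed (Var p) a"
proof
  assume "obstructed (Var p) a"
  then show False
    by (induction "Var p" a rule: obstructed.induct) auto
qed

text \<open>Conjuncts of theorems are theorems, so the derivation leads back to a
  \<open>base\<close> case that \<open>Nec_All\<close> contradicts.\<close>

lemma not_obstructed_thm:
  assumes "MS2IC a"
  shows "\<not> obstructed \<^bold>\<top> a"
proof
  assume "obstructed \<^bold>\<top> a"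
  then show False
    using assms
  proof (induction "\<^bold>\<top>" a rule: obstructed.induct)
    case (base a)
    then show ?case using thm_w Nec_All by blast
  next
    case (AndL a b)
    then show ?case using MP[OF MS2IC_taut[of "(a \<^bold>\<and> b) \<^bold>\<rightarrow> a"]] by simp
  next
    case (AndR b a)
    then show ?case using MP[OF MS2IC_taut[of "(a \<^bold>\<and> b) \<^bold>\<rightarrow> b"]] by simp
  qed
qed

text \<open>Here and in the next two lemmas the shapes of the two sides match no clause but
  \<open>base\<close>.\<close>

lemma obstructed_Top_SImp:
  "obstructed \<^bold>\<top> (a \<^bold>\<leadsto> b) \<Longrightarrow> p \<notin> vars (a \<^bold>\<leadsto> b) \<and> ([\<^bold>\<forall>] (a \<^bold>\<leadsto> b)) \<notin> w"
  by (auto elim: obstructed.cases)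

lemma obstructed_Top_Neg_SImp:
  "obstructed \<^bold>\<top> (\<^bold>\<not> (a \<^bold>\<leadsto> b)) \<Longrightarrow> p \<notin> vars (a \<^bold>\<leadsto> b) \<and> ([\<^bold>\<forall>] (\<^bold>\<not> (a \<^bold>\<leadsto> b))) \<notin> w"
  by (auto elim: obstructed.cases)

lemma obstructed_Neg_SImp_Bot:
  "obstructed (\<^bold>\<not> (a \<^bold>\<leadsto> b)) \<^bold>\<bottom> \<Longrightarrow>
    p \<notin> vars (a \<^bold>\<leadsto> b) \<and> ((\<^bold>\<not> (a \<^bold>\<leadsto> b)) \<^bold>\<leadsto> \<^bold>\<bottom>) \<notin> w"
  by (auto elim: obstructed.cases)

text \<open>Boxed pairs match only \<open>base\<close>, where \<open>Add\<close> in contrapositive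
  form carries failure back to the unboxed pair.\<close>

lemma obstructed_Box: "obstructed (\<^bold>\<box> a) (\<^bold>\<box> b) \<Longrightarrow> obstructed a b"
  by (auto elim!: obstructed.cases[of "\<^bold>\<box> a"] intro!: obstructed.base dest: Add_w)

section \<open>The interpretation and its truth condition for strict implications\<close>

primrec tr :: "fm \<Rightarrow> fm" where
  "tr (Var n) = (if n = p then \<phi> else Var n)"
| "tr \<^bold>\<top> = \<^bold>\<top>"
| "tr \<^bold>\<bottom> = \<^bold>\<bottom>"
| "tr (\<^bold>\<not> a) = \<^bold>\<not> tr a"
| "tr (a \<^bold>\<and> b) = tr a \<^bold>\<and> tr b"
| "tr (a \<^bold>\<or> b) = tr a \<^bold>\<or> tr b"
| "tr (a \<^bold>\<rightarrow> b) = tr a \<^bold>\<rightarrow> tr b"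
| "tr (a \<^bold>\<leftrightarrow> b) = (tr a \<^bold>\<leftrightarrow> tr b)"
| "tr (a \<^bold>\<leadsto> b) =
    (if p \<notin> vars (a \<^bold>\<leadsto> b) then a \<^bold>\<leadsto> b
     else if (tr a \<^bold>\<rightarrow> tr b) \<in> G \<and> \<not> obstructed a b then \<^bold>\<top> else \<^bold>\<bottom>)"
| "tr (\<^bold>\<box> a) = \<^bold>\<box> tr a"

lemma tr_fresh: "p \<notin> vars a \<Longrightarrow> tr a = a"
  by (induction a) auto

lemma tr_inst: "tr (inst \<sigma> a) = inst (tr \<circ> \<sigma>) a"
  by (induction a) auto

text \<open>Drops the case distinction made by \<open>tr\<close>: by \<open>R_fresh\<close> the same
  condition also describes the \<open>p\<close>-free strict implications.\<close>

definition R :: "fm \<Rightarrow> fm \<Rightarrow> bool" where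
  "R a b \<longleftrightarrow> (tr a \<^bold>\<rightarrow> tr b) \<in> G \<and> \<not> obstructed a b"

lemma R_fresh: "p \<notin> vars (a \<^bold>\<leadsto> b) \<Longrightarrow> R a b \<longleftrightarrow> (a \<^bold>\<leadsto> b) \<in> w"
  using obstructed_fresh[of a b] obstructed.base[of a b] Imp_G_of_SImp_w[of a b]
  by (auto simp: R_def tr_fresh)

text \<open>Together with \<open>tr_SImp_neg\<close>: \<open>G\<close> decides every translated
  strict implication according to \<open>R\<close>, so axioms can be checked on
  \<open>R\<close>.\<close>

lemma tr_SImp_pos:
  assumes "R a b"
  shows "tr (a \<^bold>\<leadsto> b) \<in> G"
proof (cases "p \<in> vars (a \<^bold>\<leadsto> b)")
  case True
  then have "tr (a \<^bold>\<leadsto> b) = \<^bold>\<top>"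
    using assms by (auto simp: R_def)
  then show ?thesis
    by (simp only:) (rule G_taut, simp)
next
  case False
  then show ?thesis
    using assms R_fresh[of a b] by (auto intro: G.pos)
qed

lemma tr_SImp_neg:
  assumes "\<not> R a b"
  shows "(\<^bold>\<not> tr (a \<^bold>\<leadsto> b)) \<in> G"
proof (cases "p \<in> vars (a \<^bold>\<leadsto> b)")
  case True
  then have "tr (a \<^bold>\<leadsto> b) = \<^bold>\<bottom>"
    using assms by (auto simp: R_def)
  then show ?thesis
    by (simp only:) (rule G_taut, simp)
next
  case False
  then show ?thesis
    using assms R_fresh[of a b] by (auto intro: G.neg)
qed

declare tr.simps(9)[simp del]

lemma tr_SImp_Imp:
  assumes "R a b \<Longrightarrow> c \<in> G"
  shows "(tr (a \<^bold>\<leadsto> b) \<^bold>\<rightarrow> c) \<in> G"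
proof (cases "R a b")
  case True
  show ?thesis by (rule G_taut1[OF assms[OF True]]) simp
next
  case False
  show ?thesis by (rule G_taut1[OF tr_SImp_neg[OF False]]) simp
qed

lemma tr_SImp_Iff:
  assumes "R a b \<Longrightarrow> c \<in> G" "\<not> R a b \<Longrightarrow> (\<^bold>\<not> c) \<in> G"
  shows "(tr (a \<^bold>\<leadsto> b) \<^bold>\<leftrightarrow> c) \<in> G"
proof (cases "R a b")
  case True
  show ?thesis by (rule G_taut2[OF assms(1)[OF True] tr_SImp_pos[OF True]]) simp
next
  case False
  show ?thesis by (rule G_taut2[OF assms(2)[OF False] tr_SImp_neg[OF False]]) simp
qed

lemma tr_SImp_Iff_And:
  assumes "R a b \<longleftrightarrow> R c d \<and> R e f"
  shows "(tr (a \<^bold>\<leadsto> b) \<^bold>\<leftrightarrow> (tr (c \<^bold>\<leadsto> d) \<^bold>\<and> tr (e \<^bold>\<leadsto> f))) \<in> G"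
proof (rule tr_SImp_Iff)
  assume "R a b"
  then show "(tr (c \<^bold>\<leadsto> d) \<^bold>\<and> tr (e \<^bold>\<leadsto> f)) \<in> G"
    using assms by (intro G_taut2[OF tr_SImp_pos[of c d] tr_SImp_pos[of e f]]) auto
next
  assume "\<not> R a b"
  then consider "\<not> R c d" | "\<not> R e f"
    using assms by blast
  then show "(\<^bold>\<not> (tr (c \<^bold>\<leadsto> d) \<^bold>\<and> tr (e \<^bold>\<leadsto> f))) \<in> G"
    by cases (rule G_taut1[OF tr_SImp_neg], assumption, simp)+
qed

section \<open>The axioms as closure properties of \<open>R\<close>\<close>

lemma R_Or: "R (a \<^bold>\<or> b) c \<longleftrightarrow> R a c \<and> R b c"
proof -
  let ?i = "\<lambda>x. (x \<^bold>\<rightarrow> tr c)"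
  have "?i (tr a \<^bold>\<or> tr b) \<in> G \<longleftrightarrow> ?i (tr a) \<in> G \<and> ?i (tr b) \<in> G"
    using G_taut1[of "?i (tr a \<^bold>\<or> tr b)" "?i (tr a)"] G_taut1[of "?i (tr a \<^bold>\<or> tr b)" "?i (tr b)"]
      G_taut2[of "?i (tr a)" "?i (tr b)" "?i (tr a \<^bold>\<or> tr b)"] by auto
  then show ?thesis
    by (auto simp: R_def obstructed_Or)
qed

lemma R_And: "R c (a \<^bold>\<and> b) \<longleftrightarrow> R c a \<and> R c b"
proof -
  let ?i = "\<lambda>x. (tr c \<^bold>\<rightarrow> x)"
  have "?i (tr a \<^bold>\<and> tr b) \<in> G \<longleftrightarrow> ?i (tr a) \<in> G \<and> ?i (tr b) \<in> G"
    using G_taut1[of "?i (tr a \<^bold>\<and> tr b)" "?i (tr a)"] G_taut1[of "?i (tr a \<^bold>\<and> tr b)" "?i (tr b)"]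
      G_taut2[of "?i (tr a)" "?i (tr b)" "?i (tr a \<^bold>\<and> tr b)"] by auto
  then show ?thesis
    by (auto simp: R_def obstructed_And)
qed

lemma R_Neg: "R (\<^bold>\<not> b) (\<^bold>\<not> a) \<longleftrightarrow> R a b"
  using G_taut1[of "tr a \<^bold>\<rightarrow> tr b" "\<^bold>\<not> tr b \<^bold>\<rightarrow> \<^bold>\<not> tr a"]
    G_taut1[of "\<^bold>\<not> tr b \<^bold>\<rightarrow> \<^bold>\<not> tr a" "tr a \<^bold>\<rightarrow> tr b"]
  by (auto simp: R_def obstructed_Neg)

lemma R_Bot: "R \<^bold>\<bottom> a" and R_Top: "R a \<^bold>\<top>"
  by (simp_all add: R_def not_obstructed_Bot not_obstructed_Top G_taut)

lemma R_Top_iff: "R \<^bold>\<top> a \<longleftrightarrow> tr a \<in> G \<and> \<not> obstructed \<^bold>\<top> a"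
  using G_taut1[of "tr a" "\<^bold>\<top> \<^bold>\<rightarrow> tr a"] G_taut1[of "\<^bold>\<top> \<^bold>\<rightarrow> tr a" "tr a"] by (auto simp: R_def)

text \<open>The translation is already in \<open>G\<close>. An obstruction would have to be
  \<open>p\<close>-free, and A10 in \<open>w\<close> excludes that.\<close>

lemma R_Top_SImp:
  assumes "R a b"
  shows "R \<^bold>\<top> (a \<^bold>\<leadsto> b)"
proof -
  have "\<not> obstructed \<^bold>\<top> (a \<^bold>\<leadsto> b)"
    using obstructed_Top_SImp[of a b] assms R_fresh[of a b] by (auto simp: All_SImp_w)
  then show ?thesis
    using tr_SImp_pos[OF assms] by (simp add: R_Top_iff)
qed

lemma R_Top_Neg_All:
  assumes "\<not> R \<^bold>\<top> a"
  shows "R \<^bold>\<top> (\<^bold>\<not> ([\<^bold>\<forall>] a))"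
proof -
  have "\<not> obstructed \<^bold>\<top> (\<^bold>\<not> ([\<^bold>\<forall>] a))"
    using obstructed_Top_Neg_SImp[of "\<^bold>\<top>" a] assms R_fresh[of "\<^bold>\<top>" a] All_Neg_All_w[of a] by blast
  then show ?thesis
    using tr_SImp_neg[OF assms] by (simp add: R_Top_iff)
qed

lemma R_Neg_All_Bot:
  assumes "R \<^bold>\<top> a"
  shows "R (\<^bold>\<not> ([\<^bold>\<forall>] a)) \<^bold>\<bottom>"
proof -
  have "\<not> obstructed (\<^bold>\<not> ([\<^bold>\<forall>] a)) \<^bold>\<bottom>"
    using obstructed_Neg_SImp_Bot[of "\<^bold>\<top>" a] assms R_fresh[of "\<^bold>\<top>" a] MP_w[OF thm_w[OF A11[of a]]]
    by blast
  moreover have "(\<^bold>\<not> tr ([\<^bold>\<forall>] a) \<^bold>\<rightarrow> \<^bold>\<bottom>) \<in> G"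
    by (rule G_taut1[OF tr_SImp_pos[OF assms]]) simp
  ultimately show ?thesis
    by (simp add: R_def)
qed

text \<open>K and closure of \<open>G\<close> under box carry over the implication;
  \<open>obstructed_Box\<close> carries over the absence of obstruction.\<close>

lemma R_Box:
  assumes "R a b"
  shows "R (\<^bold>\<box> a) (\<^bold>\<box> b)"
  using assms obstructed_Box G.mp[OF G.provable[OF K] Box_G] by (auto simp: R_def)

section \<open>Soundness of the interpretation, and the rule\<close>

lemma tr_sound: "MS2IC a \<Longrightarrow> tr a \<in> G"
proof (induction rule: MS2IC.induct)
  case (Taut a \<sigma>)
  then show ?case by (simp only: tr_inst) (intro G.provable MS2IC.Taut)
next
  case (A1 a)
  show ?case
    unfolding tr.simps(5) by (rule G_taut2[OF tr_SImp_pos[OF R_Bot] tr_SImp_pos[OF R_Top]]) simp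
next
  case (A2 a b c)
  show ?case unfolding tr.simps(5,8) by (rule tr_SImp_Iff_And[OF R_Or])
next
  case (A3 a b c)
  show ?case unfolding tr.simps(5,8) by (rule tr_SImp_Iff_And[OF R_And])
next
  case (A4 a b)
  show ?case unfolding tr.simps(7) by (rule tr_SImp_Imp) (simp add: R_def)
next
  case (A5 a b)
  show ?case
    unfolding tr.simps(8) by (rule tr_SImp_Iff) (simp_all add: tr_SImp_pos tr_SImp_neg R_Neg)
next
  case (A8 a)
  show ?case unfolding tr.simps(7) by (rule tr_SImp_Imp) (intro tr_SImp_pos R_Top_SImp)
next
  case (A9 a)
  show ?case
  proof (cases "R \<^bold>\<top> a")
    case True
    show ?thesis unfolding tr.simps(4,7) by (rule G_taut1[OF tr_SImp_pos[OF True]]) simp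
  next
    case False
    show ?thesis
      unfolding tr.simps(7) by (rule G_taut1[OF tr_SImp_pos[OF R_Top_Neg_All[OF False]]]) simp
  qed
next
  case (A10 a b)
  show ?case
    unfolding tr.simps(8)
  proof (rule tr_SImp_Iff)
    assume "R a b"
    then show "tr ([\<^bold>\<forall>] (a \<^bold>\<leadsto> b)) \<in> G"
      by (intro tr_SImp_pos R_Top_SImp)
  next
    assume "\<not> R a b"
    then have "\<not> R \<^bold>\<top> (a \<^bold>\<leadsto> b)"
      \<comment> \<open>The negated translation is in \<open>G\<close>, hence in the consistent
        \<open>w\<close>, so the translation itself cannot be in \<open>G\<close>.\<close>
      using G_subset_w[OF tr_SImp_neg[of a b]] G_subset_w by (auto simp only: R_Top_iff neg_w)
    then show "(\<^bold>\<not> tr ([\<^bold>\<forall>] (a \<^bold>\<leadsto> b))) \<in> G"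
      by (rule tr_SImp_neg)
  qed
next
  case (A11 a)
  show ?case unfolding tr.simps(7) by (rule tr_SImp_Imp) (intro tr_SImp_pos R_Neg_All_Bot)
next
  case (K a b)
  show ?case by (simp add: G.provable MS2IC.K)
next
  case (Add a b)
  show ?case unfolding tr.simps(7) by (rule tr_SImp_Imp) (intro tr_SImp_pos R_Box)
next
  case (MP a b)
  then show ?case by (auto intro: G.mp)
next
  case (Nec_All a)
  \<comment> \<open>The induction hypothesis gives only membership in \<open>G\<close>; the absence
    of obstruction comes from \<open>a\<close> being a theorem.\<close>
  then show ?case by (intro tr_SImp_pos) (simp add: R_Top_iff not_obstructed_thm)
next
  case (Nec_Box a)
  then show ?case by (simp add: Box_G)
qed

text \<open>Both sides translate to \<open>\<phi>\<close>, so the required implication is a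
  tautology.\<close>

lemma R_Var: "R (Var p) \<phi>"
  using fresh by (simp add: R_def not_obstructed_Var tr_fresh G_taut)

end

theorem theorem4p12:
  fixes p :: nat and \<phi> \<psi> :: fm
  assumes "p \<notin> vars \<phi>" and "p \<notin> vars \<psi>"
    and "MS2IC (((Var p \<^bold>\<leadsto> \<phi>) \<^bold>\<and> Var p) \<^bold>\<rightarrow> \<psi>)"
  shows "MS2IC (\<phi> \<^bold>\<rightarrow> \<psi>)"
proof (rule ccontr)
  assume "\<not> MS2IC (\<phi> \<^bold>\<rightarrow> \<psi>)"
  then obtain w where w: "theory_set w" "(\<phi> \<^bold>\<rightarrow> \<psi>) \<notin> w" "\<And>a. (\<^bold>\<not> a) \<in> w \<longleftrightarrow> a \<notin> w"
    by (rule maximal_theory_exists) blast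
  interpret fresh_interpretation w p \<phi>
    using w assms(1) by unfold_locales auto
  have "((tr (Var p \<^bold>\<leadsto> \<phi>) \<^bold>\<and> \<phi>) \<^bold>\<rightarrow> \<psi>) \<in> G"
    using tr_sound[OF assms(3)] unfolding tr.simps(1,5,7) by (simp only: tr_fresh[OF assms(2)] if_True refl)
  \<comment> \<open>The translated strict implication is itself in \<open>G\<close> by
    \<open>R_Var\<close>, so it can be discharged from the antecedent.\<close>
  then have "(\<phi> \<^bold>\<rightarrow> \<psi>) \<in> G"
    by (rule G_taut2[OF _ tr_SImp_pos[OF R_Var]]) simp
  then show False
    using G_subset_w w(2) by blast
qed

end
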